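(* Let $G$ be a finite connected bipartite graph with diameter $d$. Suppose $G$ has a partition into $p\ge 2$ paths, each having at least $k\ge 2$ vertices. Then for every integer $r\ge 2$ satisfying $k^r\ge (dr)^2$, the graph $G^r$ is stackable.
   Context: A partition of $G$ into paths means a collection of vertex-disjoint paths in $G$ (not necessarily induced) covering all vertices. $G^r$ denotes the $r$-fold Cartesian product $G\,\square\,\cdots\,\square\, G$, where $G\,\square\, H$ has vertex set $V(G)\times V(H)$ and $(v,w)\sim(v',w')$ iff ($v=v'$ and $ww'\in E(H)$) or ($vv'\in E(G)$ and $w=w'$). Cup stacking on a finite connected graph: initially one cup on every vertex; a move takes all $r\ge1$ cups from a vertex $x$ onto a vertex $y\neq x$ that already carries at least one cup and satisfies $d(x,y)=r$ (shortest-path distance). The graph is $t$-stackable if some sequence of moves ends with all cups on $t$, and stackable if $t$-stackable for every vertex $t$. *)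

theory Defs
  imports "Graph_Theory.Graph_Theory" "HOL-Library.Disjoint_Sets"
begin

text \<open>
  A finite simple graph is a \<^const>\<open>pair_graph\<close>: each edge is represented by its two
  opposite arcs. Paths are duplicate-free vertex lists (\<^const>\<open>vpath\<close>), so the
  number of vertices of a path is the length of the list.
\<close>

text \<open>Junk value if \<open>v\<close> is not reachable from \<open>u\<close>; only used for connected graphs.\<close>

definition graph_dist :: "'a pair_pre_digraph \<Rightarrow> 'a \<Rightarrow> 'a \<Rightarrow> nat" where
  "graph_dist G u v = (LEAST n. \<exists>p. pre_digraph.awalk (with_proj G) u p v \<and> length p = n)"

definition graph_diameter :: "'a pair_pre_digraph \<Rightarrow> nat" where
  "graph_diameter G = Max {graph_dist G u v | u v. u \<in> pverts G \<and> v \<in> pverts G}"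

definition bipartite :: "'a pair_pre_digraph \<Rightarrow> bool" where
  "bipartite G \<longleftrightarrow>
     (\<exists>A B. A \<union> B = pverts G \<and> A \<inter> B = {} \<and> parcs G \<subseteq> (A \<times> B) \<union> (B \<times> A))"

definition path_partition :: "'a pair_pre_digraph \<Rightarrow> 'a list set \<Rightarrow> bool" where
  "path_partition G P \<longleftrightarrow>
     finite P \<and> (\<forall>q\<in>P. vpath q (with_proj G)) \<and>
     disjoint_family_on set P \<and> (\<Union>q\<in>P. set q) = pverts G"

definition cart_prod ::
  "'a pair_pre_digraph \<Rightarrow> 'b pair_pre_digraph \<Rightarrow> ('a \<times> 'b) pair_pre_digraph" where
  "cart_prod G H =
     \<lparr>pverts = pverts G \<times> pverts H,
      parcs = {((v, w), (v', w')) | v w v' w'.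
        (v, w) \<in> pverts G \<times> pverts H \<and> (v', w') \<in> pverts G \<times> pverts H \<and>
        (v = v' \<and> (w, w') \<in> parcs H \<or> (v, v') \<in> parcs G \<and> w = w')}\<rparr>"

definition relabel :: "('a \<Rightarrow> 'b) \<Rightarrow> 'a pair_pre_digraph \<Rightarrow> 'b pair_pre_digraph" where
  "relabel f G = \<lparr>pverts = f ` pverts G, parcs = map_prod f f ` parcs G\<rparr>"

text \<open>
  The type of nested tuples would depend on the exponent, so the vertex
  \<open>(x\<^sub>1, (x\<^sub>2, \<dots>))\<close> of an iterated product is renamed to the list
  \<open>[x\<^sub>1, x\<^sub>2, \<dots>]\<close>. The zeroth power is the one-vertex graph.
\<close>

primrec cart_power :: "'a pair_pre_digraph \<Rightarrow> nat \<Rightarrow> 'a list pair_pre_digraph" where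
  "cart_power G 0 = \<lparr>pverts = {[]}, parcs = {}\<rparr>"
| "cart_power G (Suc r) = relabel (\<lambda>(x, xs). x # xs) (cart_prod G (cart_power G r))"

text \<open>A configuration maps each vertex to the number of cups on it.\<close>

inductive cup_move :: "'a pair_pre_digraph \<Rightarrow> ('a \<Rightarrow> nat) \<Rightarrow> ('a \<Rightarrow> nat) \<Rightarrow> bool"
  for G where
  "\<lbrakk>x \<in> pverts G; y \<in> pverts G; x \<noteq> y; c x \<ge> 1; c y \<ge> 1; graph_dist G x y = c x\<rbrakk>
   \<Longrightarrow> cup_move G c (c(x := 0, y := c y + c x))"

definition initial_cups :: "'a pair_pre_digraph \<Rightarrow> 'a \<Rightarrow> nat" where
  "initial_cups G v = (if v \<in> pverts G then 1 else 0)"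

definition stackable_at :: "'a pair_pre_digraph \<Rightarrow> 'a \<Rightarrow> bool" where
  "stackable_at G t \<longleftrightarrow>
     (\<exists>c. (cup_move G)\<^sup>*\<^sup>* (initial_cups G) c \<and> (\<forall>v. v \<noteq> t \<longrightarrow> c v = 0))"

definition stackable :: "'a pair_pre_digraph \<Rightarrow> bool" where
  "stackable G \<longleftrightarrow> (\<forall>t\<in>pverts G. stackable_at G t)"

lemma graph_dist_eq_\<mu>:
  assumes "wf_digraph (with_proj G)" and "u \<rightarrow>\<^sup>*\<^bsub>with_proj G\<^esub> v"
  shows "wf_digraph.\<mu> (with_proj G) (\<lambda>_. 1) u v = ereal (real (graph_dist G u v))"
proof -
  interpret wf_digraph "with_proj G" by fact
  have cost: "awalk_cost (\<lambda>_. 1) p = real (length p)" for p :: "('a \<times> 'a) list"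
    by (induct p) auto
  have ex: "\<exists>n p. awalk u p v \<and> length p = n"
    using assms(2) by (auto simp: reachable_awalk)
  from LeastI_ex[OF ex] obtain p where p: "awalk u p v" "length p = graph_dist G u v"
    unfolding graph_dist_def by blast
  have le: "graph_dist G u v \<le> length q" if "awalk u q v" for q
    unfolding graph_dist_def using that by (intro Least_le) blast
  show ?thesis
    unfolding \<mu>_def
  proof (rule antisym)
    show "(INF p\<in>{p. awalk u p v}. ereal (awalk_cost (\<lambda>_. 1) p)) \<le> ereal (real (graph_dist G u v))"
      using p by (intro INF_lower2[of p]) (auto simp: cost)
    show "ereal (real (graph_dist G u v)) \<le> (INF p\<in>{p. awalk u p v}. ereal (awalk_cost (\<lambda>_. 1) p))"
      using le by (intro INF_greatest) (auto simp: cost)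
  qed
qed

lemma pverts_cart_power: "pverts (cart_power G r) = {xs. length xs = r \<and> set xs \<subseteq> pverts G}"
proof (induct r)
  case (Suc r)
  then show ?case
    by (auto simp: relabel_def cart_prod_def image_iff length_Suc_conv)
qed auto

lemma parcs_cart_power_Suc:
  "(x # xs, y # ys) \<in> parcs (cart_power G (Suc r)) \<longleftrightarrow>
     x \<in> pverts G \<and> y \<in> pverts G \<and> xs \<in> pverts (cart_power G r) \<and> ys \<in> pverts (cart_power G r) \<and>
     (x = y \<and> (xs, ys) \<in> parcs (cart_power G r) \<or> (x, y) \<in> parcs G \<and> xs = ys)"
  by (force simp: relabel_def cart_prod_def image_iff)

lemma pair_graph_cart_power:
  assumes "pair_graph G"
  shows "pair_graph (cart_power G r)"
proof (induct r)
  case 0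
  show ?case by unfold_locales (auto simp: symmetric_def sym_def)
next
  case (Suc r)
  interpret G: pair_graph G by fact
  interpret H: pair_graph "cart_power G r" by fact
  have sG: "(x, y) \<in> parcs G \<Longrightarrow> (y, x) \<in> parcs G" for x y
    using G.pair_sym_arcs by (auto simp: symmetric_def sym_def)
  have sH: "(x, y) \<in> parcs (cart_power G r) \<Longrightarrow> (y, x) \<in> parcs (cart_power G r)" for x y
    using H.pair_sym_arcs by (auto simp: symmetric_def sym_def)
  let ?P = "cart_power G (Suc r)"
  have fin: "finite (pverts ?P)"
    using G.pair_finite_verts H.pair_finite_verts by (simp add: relabel_def cart_prod_def)
  have sub: "parcs ?P \<subseteq> pverts ?P \<times> pverts ?P"
    by (auto simp: relabel_def cart_prod_def)
  have irr: "fst e \<noteq> snd e" if "e \<in> parcs ?P" for e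
    using that G.pair_no_loops H.pair_no_loops
    by (fastforce simp: relabel_def cart_prod_def)
  have sym: "sym (parcs ?P)"
    unfolding sym_def by (auto simp: relabel_def cart_prod_def image_iff intro: sG sH)
  show ?case
    by unfold_locales
      (use fin sub irr sym finite_subset[OF sub] in \<open>auto simp: symmetric_def simp del: cart_power.simps\<close>)
qed

end

theory Submission
  imports Defs
begin

text \<open>
  Every path can be stacked onto any of its vertices \<open>v\<close>: along an arm leaving \<open>v\<close> the distance
  to \<open>v\<close> starts at 1 and grows by at most one per step, so the arm can be cut from its far end into
  blocks, each containing a vertex whose distance to \<open>v\<close> is the size of the block. By induction
  a block is stacked onto that vertex, which then jumps to \<open>v\<close>.

  The power of \<open>G\<close> is partitioned into grids, each traversed by a Hamiltonian path. The grid
  containing the target \<open>t\<close> is stacked onto \<open>t\<close>. Along the path of any other grid, the distances to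
  \<open>t\<close> form a sequence of at least \<open>D\<^sup>2\<close> numbers in \<open>{1..D}\<close> with steps \<open>\<plusminus>1\<close>, where \<open>D = d r\<close>.
  It can again be cut into blocks containing their own size: \<open>w\<close> consecutive end points of
  tileable prefixes yield \<open>w + 1\<close> consecutive ones at most \<open>D + 1\<close> further on, and
  \<open>D\<close> consecutive ones cannot be jumped over when cutting from the other end.
  The only obstruction is a sequence starting with 2, 1; since \<open>r \<ge> 2\<close>, a suitable
  first direction of the Hamiltonian path avoids it.
\<close>

section \<open>Tileable sequences\<close>

text \<open>The entries stand for distances to a target. The cups of a block reach it together: they
  are gathered on a vertex whose distance is the size of the block, and this stack then
  jumps.\<close>

inductive tileable :: "nat list \<Rightarrow> bool" where
  Nil: "tileable []"
| block: "length ys \<in> set ys \<Longrightarrow> tileable zs \<Longrightarrow> tileable (ys @ zs)"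

lemma tileable_append: "tileable xs \<Longrightarrow> tileable ys \<Longrightarrow> tileable (xs @ ys)"
  by (induct rule: tileable.induct) (auto intro: tileable.intros)

lemma tileable_single_block: "length ys \<in> set ys \<Longrightarrow> tileable ys"
  using tileable.block[OF _ tileable.Nil, of ys] by simp

lemma nth_in_set_take_drop:
  assumes "e \<le> k" "k < e + l" "e + l \<le> length zs"
  shows "zs ! k \<in> set (take l (drop e zs))"
proof -
  have "take l (drop e zs) ! (k - e) = zs ! k" "k - e < length (take l (drop e zs))"
    using assms by auto
  then show ?thesis by (metis nth_mem)
qed

text \<open>The block of length \<open>zs ! k\<close> starting at \<open>e\<close> covers position
  \<open>k\<close>, hence contains its own size. So an entry advances a tileable prefix end by its
  own value.\<close>

lemma tileable_take_add:
  assumes "tileable (take e zs)" "e \<le> k" "k < e + zs ! k" "e + zs ! k \<le> length zs"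
  shows "tileable (take (e + zs ! k) zs)"
proof -
  have "tileable (take (zs ! k) (drop e zs))"
    using nth_in_set_take_drop[OF assms(2-4)] assms(4) by (intro tileable_single_block) simp
  with assms(1) show ?thesis by (simp add: take_add tileable_append)
qed

text \<open>Mirror image of \<open>tileable_take_add\<close>, for cutting blocks from the far
  end.\<close>

lemma tileable_drop_diff:
  assumes "tileable (drop (e + zs ! k) zs)" "e \<le> k" "k < e + zs ! k" "e + zs ! k \<le> length zs"
  shows "tileable (drop e zs)"
proof -
  have "length (take (zs ! k) (drop e zs)) \<in> set (take (zs ! k) (drop e zs))"
    using nth_in_set_take_drop[OF assms(2-4)] assms(4) by simp
  from tileable.block[OF this assms(1)] show ?thesis
    by (metis add.commute append_take_drop_id drop_drop)
qed

text \<open>Cut off the last block, whose length is the last entry.\<close>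

lemma tileable_if_slowly_growing:
  assumes "\<And>i. i < length zs \<Longrightarrow> 0 < zs ! i"
    and "zs \<noteq> [] \<Longrightarrow> zs ! 0 \<le> 1"
    and "\<And>i. Suc i < length zs \<Longrightarrow> zs ! Suc i \<le> zs ! i + 1"
  shows "tileable zs"
proof -
  \<comment> \<open>Hence the block that ends at \<open>i\<close> never reaches beyond the beginning
    of the list.\<close>
  have bound: "zs ! i \<le> Suc i" if "i < length zs" for i
    using that
  proof (induct i)
    case 0
    then show ?case using assms(2) by auto
  next
    case (Suc i)
    then show ?case using assms(3)[of i] by auto
  qed
  have "tileable (take m zs)" if "m \<le> length zs" for m
    using that
  proof (induct m rule: less_induct)
    case (less m)
    show ?case
    proof (cases m)
      case 0
      then show ?thesis by (simp add: tileable.Nil)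
    next
      case (Suc i)
      have b: "zs ! i \<le> m" "0 < zs ! i"
        using bound[of i] assms(1)[of i] less.prems Suc by auto
      then have "tileable (take (m - zs ! i) zs)" using less Suc by simp
      from tileable_take_add[OF this, of i] show ?thesis using b less.prems Suc by simp
    qed
  qed
  from this[of "length zs"] show ?thesis by simp
qed

section \<open>Sequences with steps of plus or minus one\<close>

text \<open>Models the distances to a vertex along a path avoiding it in a connected bipartite
  graph: positive by avoidance, with unit steps by parity.\<close>

locale zigzag =
  fixes zs :: "nat list" and D :: nat
  assumes pos: "i < length zs \<Longrightarrow> 0 < zs ! i"
    and le: "i < length zs \<Longrightarrow> zs ! i \<le> D"
    and step: "Suc i < length zs \<Longrightarrow> zs ! Suc i = zs ! i + 1 \<or> zs ! i = zs ! Suc i + 1"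
begin

definition run :: "nat \<Rightarrow> nat \<Rightarrow> bool" where
  "run x w \<longleftrightarrow> (\<forall>e. x \<le> e \<and> e < x + w \<longrightarrow> tileable (take e zs))"

lemma run_Suc: "run x w \<Longrightarrow> tileable (take (x + w) zs) \<Longrightarrow> run x (Suc w)"
  unfolding run_def by (metis add_Suc_right less_SucE)

lemma run_Suc_left: "run (Suc x) w \<Longrightarrow> tileable (take x zs) \<Longrightarrow> run x (Suc w)"
  unfolding run_def by (metis Suc_leI add_Suc_right add_Suc_shift le_neq_implies_less)

text \<open>Position \<open>k\<close> is not before the last end of the run and is within reach of a
  block of length \<open>zs ! k\<close> from the first, so this one block length serves every end of
  the run.\<close>

lemma run_shift:
  assumes "run x w" "k + 1 \<ge> x + w" "k < x + zs ! k" "x + w + zs ! k \<le> length zs + 1"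
  shows "run (x + zs ! k) w"
  unfolding run_def
proof (intro allI impI)
  fix z assume z: "x + zs ! k \<le> z \<and> z < x + zs ! k + w"
  define e where "e = z - zs ! k"
  have e: "z = e + zs ! k" "x \<le> e" "e < x + w" using z by (auto simp: e_def)
  have "tileable (take (e + zs ! k) zs)"
    using e assms by (intro tileable_take_add) (auto simp: run_def)
  then show "tileable (take z zs)" using e by simp
qed

text \<open>The last \<open>e\<close> for which the block from \<open>e\<close> to the end of the run has an entry not
  exceeding its length has an entry equal to its length, because the entries change by one.\<close>

lemma run_extend:
  assumes run: "run x w" and p: "x \<le> p" "p < x + w" "zs ! p \<le> w" and len: "x + w \<le> length zs"
  shows "run x (Suc w)"
proof -
  define Q where "Q e \<longleftrightarrow> x \<le> e \<and> e < x + w \<and> (\<exists>k. e \<le> k \<and> k < x + w \<and> zs ! k \<le> x + w - e)" for e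
  have "Q x" using p by (auto simp: Q_def)
  moreover have bd: "\<And>e. Q e \<Longrightarrow> e \<le> x + w" by (auto simp: Q_def)
  ultimately obtain e where e: "Q e" "\<And>e'. Q e' \<Longrightarrow> e' \<le> e"
    using GreatestI_nat[of Q x "x + w"] Greatest_le_nat[of Q _ "x + w"] by blast
  from e(1) obtain k where k: "x \<le> e" "e < x + w" "e \<le> k" "k < x + w" "zs ! k \<le> x + w - e"
    by (auto simp: Q_def)
  \<comment> \<open>A smaller entry would make \<open>Suc e\<close> satisfy \<open>Q\<close>,
    against the maximality of \<open>e\<close>.\<close>
  have big: "x + w - e \<le> zs ! k'" if "e < k'" "k' < x + w" for k'
  proof (rule ccontr)
    assume "\<not> ?thesis"
    then have "Q (Suc e)" using that k unfolding Q_def by (intro conjI exI[of _ k']) auto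
    then show False using e(2) by fastforce
  qed
  have "\<exists>k. e \<le> k \<and> k < x + w \<and> zs ! k = x + w - e"
  proof (cases "k = e")
    case False
    then show ?thesis using big[of k] k by (intro exI[of _ k]) auto
  next
    case True
    show ?thesis
    proof (cases "Suc e < x + w")
      case True
      then have "x + w - e \<le> zs ! Suc e" using big[of "Suc e"] by simp
      \<comment> \<open>The entries at \<open>e\<close> and \<open>Suc e\<close> differ by one and
        enclose \<open>x + w - e\<close>.\<close>
      with step[of e] True \<open>k = e\<close> k len
      have "zs ! e = x + w - e \<or> zs ! Suc e = x + w - e" by fastforce
      then show ?thesis using True k by (metis le_refl le_SucI)
    next
      case False
      then have "zs ! e = x + w - e" using k \<open>k = e\<close> pos[of e] len by auto
      then show ?thesis using k by blast
    qed
  qed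
  then obtain k where k': "e \<le> k" "k < x + w" "zs ! k = x + w - e" by blast
  have "tileable (take (e + zs ! k) zs)"
    using k k' run len by (intro tileable_take_add) (auto simp: run_def)
  then have "tileable (take (x + w) zs)" using k k' by simp
  with run show ?thesis by (rule run_Suc)
qed

text \<open>If every entry inside the run exceeds \<open>w\<close>, the last one, \<open>a\<close>,
  shifts the whole run, and a block through the following entry, \<open>a + 1\<close> or
  \<open>a - 1\<close>, adds one more end on the right or on the left. Only \<open>a = w + 1\<close>
  followed by \<open>w\<close> needs separate treatment.\<close>

lemma run_grow:
  assumes run: "run x w" and w: "0 < w" "w < D" and len: "x + w + D < length zs"
    and start: "w = 1 \<Longrightarrow> \<not> (zs ! x = 2 \<and> zs ! Suc x = 1)"
  shows "\<exists>x'. run x' (Suc w) \<and> x' + Suc w \<le> x + w + D + 1"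
proof (cases "\<exists>p. x \<le> p \<and> p < x + w \<and> zs ! p \<le> w")
  case True
  then show ?thesis using run_extend[OF run] len w by (intro exI[of _ x]) auto
next
  case False
  define y where "y = x + w - 1"
  define a where "a = zs ! y"
  have y: "x \<le> y" "y < length zs" "Suc y = x + w" using w len by (auto simp: y_def)
  have a: "w < a" "a \<le> D" using False[simplified, rule_format, of y] y le[of y]
    by (auto simp: a_def)
  have shift: "run (x + a) w"
    unfolding a_def using run y a len by (intro run_shift) (auto simp: a_def)
  consider (up) "zs ! Suc y = a + 1" | (down) "a = zs ! Suc y + 1"
    using step[of y] y len by (auto simp: a_def)
  then show ?thesis
  proof cases
    case up
    have D: "a + 1 \<le> D" using le[of "Suc y"] y len up by simp
    have "tileable (take (y + zs ! Suc y) zs)"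
      using run y up a len by (intro tileable_take_add) (auto simp: run_def)
    moreover have "y + zs ! Suc y = x + a + w" using up y by simp
    ultimately have "run (x + a) (Suc w)" using run_Suc[OF shift] by simp
    then show ?thesis using D by (intro exI[of _ "x + a"]) auto
  next
    case down
    show ?thesis
    proof (cases "a = w + 1")
      case False
      have "tileable (take (x + zs ! Suc y) zs)"
        using run y down a len False w by (intro tileable_take_add) (auto simp: run_def)
      moreover have "run (Suc (x + zs ! Suc y)) w" using shift down by simp
      ultimately have "run (x + zs ! Suc y) (Suc w)" by (intro run_Suc_left)
      then show ?thesis using down a by (intro exI[of _ "x + zs ! Suc y"]) auto
    next
      case True
      \<comment> \<open>The pattern 2, 1 at \<open>x\<close> is what \<open>start\<close>
        excludes.\<close>
      have "w \<noteq> 1"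
      proof
        assume "w = 1"
        then have "y = x" using y by simp
        with \<open>w = 1\<close> show False using start True down by (simp add: a_def)
      qed
      then have w2: "2 \<le> w" using w by simp
      have sh: "run (x + w + 1) w" using shift True by simp
      \<comment> \<open>If neither of the two entries after position \<open>x + w\<close> is at most
        \<open>w\<close>, they are \<open>w + 1\<close> and \<open>w + 2\<close>. A block of length
        \<open>w + 2\<close> from \<open>y\<close> then reaches the second one because
        \<open>2 \<le> w\<close>, and it ends just after the shifted run.\<close>
      have "run (x + w + 1) (Suc w)"
      proof (cases "zs ! (x + w + 1) \<le> w \<or> zs ! (x + w + 2) \<le> w")
        case True
        then obtain p where "x + w + 1 \<le> p" "p < x + w + 1 + w" "zs ! p \<le> w"
          using that[of "x + w + 1"] that[of "x + w + 2"] w2 by auto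
        then show ?thesis using len w by (intro run_extend[OF sh]) auto
      next
        case False
        have "zs ! Suc (x + w) = w + 1"
          using False step[of "x + w"] len w down True y by auto
        then have "zs ! (x + w + 2) = w + 2"
          using False step[of "x + w + 1"] len w by auto
        moreover have "tileable (take (y + zs ! (x + w + 2)) zs)"
          using run y calculation w2 w len by (intro tileable_take_add) (auto simp: run_def)
        moreover have "y + zs ! (x + w + 2) = x + w + 1 + w" using calculation(1) y by simp
        ultimately show ?thesis using run_Suc[OF sh] by metis
      qed
      then show ?thesis using w by (intro exI[of _ "x + w + 1"]) auto
    qed
  qed
qed

text \<open>Blocks cut from the far end, each as long as its last entry, have length at most
  \<open>D\<close>, so some cut falls among the \<open>D\<close> consecutive ends of the
  run.\<close>

lemma tileable_if_run:
  assumes "run x D" "x + D \<le> Suc (length zs)" "0 < D"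
  shows "tileable zs"
proof -
  have "tileable zs" if "x \<le> b" "b \<le> length zs" "tileable (drop b zs)" for b
    using that
  proof (induct b rule: less_induct)
    case (less b)
    show ?case
    proof (cases "b < x + D")
      case True
      then have "tileable (take b zs)" using assms less.prems by (auto simp: run_def)
      from tileable_append[OF this less.prems(3)] show ?thesis by simp
    next
      case False
      define l where "l = zs ! (b - 1)"
      have b: "b \<ge> 1" using False assms(3) by simp
      have l: "0 < l" "l \<le> D" using pos[of "b - 1"] le[of "b - 1"] b less.prems by (auto simp: l_def)
      have lb: "l \<le> b" "x \<le> b - l" using l False by linarith+
      have "tileable (drop (b - l) zs)"
        using tileable_drop_diff[of "b - l" zs "b - 1", folded l_def] less.prems b l lb by simp
      moreover have "b - l < b" "b - l \<le> length zs" using l lb b less.prems by simp_all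
      ultimately show ?thesis using less.hyps[of "b - l"] lb by blast
    qed
  qed
  from this[of "length zs"] assms show ?thesis
    by (simp add: tileable.Nil)
qed

lemma tileable_if_long:
  assumes len: "D\<^sup>2 \<le> length zs" and start: "\<not> (zs ! 0 = 2 \<and> zs ! 1 = 1)"
  shows "tileable zs"
proof (cases "D = 0")
  case True
  then show ?thesis using pos[of 0] le[of 0] by (cases zs) (auto intro: tileable.Nil)
next
  case False
  \<comment> \<open>Starting from the empty prefix, each widening costs at most
    \<open>D + 1\<close>. The clause for \<open>w = 1\<close> keeps the run at 0, where
    \<open>start\<close> applies.\<close>
  have "\<exists>x. run x w \<and> x + w \<le> 1 + (w - 1) * (D + 1) \<and> (w = 1 \<longrightarrow> x = 0)"
    if "1 \<le> w" "w \<le> D" for w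
    using that
  proof (induct w rule: dec_induct)
    case base
    then show ?case by (intro exI[of _ 0]) (auto simp: run_def intro: tileable.Nil)
  next
    case (step w)
    then obtain x where x: "run x w" "x + w \<le> 1 + (w - 1) * (D + 1)" "w = 1 \<longrightarrow> x = 0" by auto
    have "(w - 1) * (D + 1) \<le> (D - 2) * (D + 1)" using step by (intro mult_right_mono) auto
    moreover have "(D - 2) * (D + 1) + D + 2 = D\<^sup>2" if "D = n + 2" for n
      using that by (simp add: power2_eq_square algebra_simps)
    moreover have "D = (D - 2) + 2" using step by simp
    ultimately have "x + w + D < length zs" using x(2) len by fastforce
    from run_grow[OF x(1) _ _ this] obtain x' where
      "run x' (Suc w)" "x' + Suc w \<le> x + w + D + 1"
      using step x(3) start by fastforce
    moreover have "(w - 1) * (D + 1) + (D + 1) = w * (D + 1)" using step by (cases w) auto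
    ultimately show ?case using x(2) step by (intro exI[of _ x']) auto
  qed
  from this[of D] False obtain x where x: "run x D" "x + D \<le> 1 + (D - 1) * (D + 1)" by auto
  \<comment> \<open>The final bound is exactly the assumed length.\<close>
  moreover have "1 + (D - 1) * (D + 1) = D\<^sup>2" using False
    by (cases D) (auto simp: power2_eq_square algebra_simps)
  ultimately show ?thesis using tileable_if_run[of x] len False by simp
qed

end

section \<open>Distances and gathering along paths\<close>

text \<open>Connectivity as plain reachability makes every distance the length of some walk, and it
  passes to powers in this form.\<close>

locale connected_pair_graph = pair_graph +
  assumes reachable: "u \<in> pverts G \<Longrightarrow> v \<in> pverts G \<Longrightarrow> u \<rightarrow>\<^sup>*\<^bsub>with_proj G\<^esub> v"
begin

lemma graph_dist_awalk:
  assumes "u \<in> pverts G" "v \<in> pverts G"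
  obtains p where "awalk u p v" "length p = graph_dist G u v"
proof -
  have "\<exists>n p. awalk u p v \<and> length p = n"
    using reachable[OF assms] by (auto simp: reachable_awalk)
  from LeastI_ex[OF this] show ?thesis using that unfolding graph_dist_def by blast
qed

lemma graph_dist_le: "awalk u p v \<Longrightarrow> graph_dist G u v \<le> length p"
  unfolding graph_dist_def by (intro Least_le) blast

lemma graph_dist_eq_0_iff:
  assumes "u \<in> pverts G" "v \<in> pverts G"
  shows "graph_dist G u v = 0 \<longleftrightarrow> u = v"
proof
  assume "graph_dist G u v = 0"
  with graph_dist_awalk[OF assms] show "u = v" by (metis awalk_Nil_iff length_0_conv)
next
  assume "u = v"
  then show "graph_dist G u v = 0" using graph_dist_le[of u "[]" v] assms by (simp add: awalk_Nil_iff)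
qed

lemma graph_dist_arc_le:
  assumes "(u, v) \<in> parcs G" "w \<in> pverts G"
  shows "graph_dist G u w \<le> graph_dist G v w + 1"
proof -
  obtain p where p: "awalk v p w" "length p = graph_dist G v w"
    using graph_dist_awalk assms in_arcsD2 by metis
  have "awalk u ((u, v) # p) w" using p assms in_arcsD1 by (simp add: awalk_Cons_iff)
  from graph_dist_le[OF this] p show ?thesis by simp
qed

lemma graph_dist_closer:
  assumes "u \<in> pverts G" "w \<in> pverts G" "u \<noteq> w"
  obtains v where "(u, v) \<in> parcs G" "graph_dist G v w < graph_dist G u w"
proof -
  obtain p where p: "awalk u p w" "length p = graph_dist G u w"
    using graph_dist_awalk assms by metis
  show ?thesis
  proof (cases p)
    case Nil
    then show ?thesis using p assms by (auto simp: awalk_Nil_iff)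
  next
    case (Cons e q)
    then have "e \<in> parcs G" "fst e = u" "awalk (snd e) q w" using p by (auto simp: awalk_Cons_iff)
    then show ?thesis using that[of "snd e"] graph_dist_le[of "snd e" q w] p Cons by (cases e) auto
  qed
qed

lemma graph_dist_le_diameter:
  assumes "u \<in> pverts G" "v \<in> pverts G"
  shows "graph_dist G u v \<le> graph_diameter G"
  unfolding graph_diameter_def
proof (rule Max_ge)
  have "{graph_dist G u v |u v. u \<in> pverts G \<and> v \<in> pverts G}
      = (\<lambda>(u, v). graph_dist G u v) ` (pverts G \<times> pverts G)" by auto
  then show "finite {graph_dist G u v |u v. u \<in> pverts G \<and> v \<in> pverts G}"
    using pair_finite_verts by simp
qed (use assms in blast)

lemma graph_dist_parity:
  assumes "bipartite G"
  obtains A where "\<And>u v. u \<in> pverts G \<Longrightarrow> v \<in> pverts G \<Longrightarrow> even (graph_dist G u v) \<longleftrightarrow> (u \<in> A \<longleftrightarrow> v \<in> A)"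
    and "\<And>u v. (u, v) \<in> parcs G \<Longrightarrow> u \<in> A \<longleftrightarrow> v \<notin> A"
proof -
  from assms obtain A B where AB: "A \<union> B = pverts G" "A \<inter> B = {}" "parcs G \<subseteq> (A \<times> B) \<union> (B \<times> A)"
    by (auto simp: bipartite_def)
  then have arc: "u \<in> A \<longleftrightarrow> v \<notin> A" if "(u, v) \<in> parcs G" for u v
    using that by blast
  have walk: "even (length p) \<longleftrightarrow> (u \<in> A \<longleftrightarrow> v \<in> A)" if "awalk u p v" for u p v
    using that
  proof (induct p arbitrary: u)
    case (Cons e p)
    then show ?case using arc[of u "snd e"] by (cases e) (auto simp: awalk_Cons_iff)
  qed (auto simp: awalk_Nil_iff)
  show ?thesis
  proof (rule that[OF _ arc])
    show "even (graph_dist G u v) \<longleftrightarrow> (u \<in> A \<longleftrightarrow> v \<in> A)" if "u \<in> pverts G" "v \<in> pverts G" for u v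
      using graph_dist_awalk[OF that] walk by metis
  qed
qed

text \<open>The arc inequality, used in both directions, bounds the change by one, and parity
  excludes equality.\<close>

lemma graph_dist_arc_cases:
  assumes "bipartite G" "(u, v) \<in> parcs G" "w \<in> pverts G"
  shows "graph_dist G v w = graph_dist G u w + 1 \<or> graph_dist G u w = graph_dist G v w + 1"
proof -
  have "graph_dist G u w \<noteq> graph_dist G v w"
    using graph_dist_parity[OF assms(1)] assms(2,3) in_arcsD1 in_arcsD2 by metis
  then show ?thesis
    using graph_dist_arc_le[OF assms(2,3)] graph_dist_arc_le[OF arcs_symmetric[OF assms(2)] assms(3)]
    by linarith
qed

end

text \<open>Identifies distances without knowing shortest walks: by \<open>lip\<close> every walk to
  \<open>t\<close> has length at least \<open>g x\<close>, and following \<open>desc\<close> down to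
  \<open>t\<close> gives one of length at most \<open>g x\<close>.\<close>

lemma (in pair_graph) reachable_and_graph_dist_eqI:
  assumes "t \<in> pverts G" "g t = 0"
    and lip: "\<And>x y. (x, y) \<in> parcs G \<Longrightarrow> g x \<le> g y + 1"
    and desc: "\<And>x. x \<in> pverts G \<Longrightarrow> x \<noteq> t \<Longrightarrow> \<exists>y. (x, y) \<in> parcs G \<and> g y < g x"
    and "x \<in> pverts G"
  shows "x \<rightarrow>\<^sup>*\<^bsub>with_proj G\<^esub> t" and "graph_dist G x t = g x"
proof -
  have lower: "g x \<le> length p" if "awalk x p t" for x p
    using that
  proof (induct p arbitrary: x)
    case (Cons e p)
    then show ?case using lip[of x "snd e"] by (cases e) (fastforce simp: awalk_Cons_iff)
  qed (use assms(2) in \<open>auto simp: awalk_Nil_iff\<close>)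
  have "\<exists>p. awalk x p t \<and> length p \<le> g x" using assms(5)
  proof (induct "g x" arbitrary: x rule: less_induct)
    case less
    show ?case
    proof (cases "x = t")
      case True
      then show ?thesis using assms(1) by (intro exI[of _ "[]"]) (simp add: awalk_Nil_iff)
    next
      case False
      from desc[OF less.prems this] obtain y where y: "(x, y) \<in> parcs G" "g y < g x" by blast
      from less.hyps[OF y(2)] in_arcsD2[OF y(1)] obtain p where "awalk y p t" "length p \<le> g y" by blast
      then show ?thesis using y less.prems by (intro exI[of _ "(x, y) # p"]) (auto simp: awalk_Cons_iff)
    qed
  qed
  then obtain p where p: "awalk x p t" "length p \<le> g x" by blast
  then show "x \<rightarrow>\<^sup>*\<^bsub>with_proj G\<^esub> t" by (auto simp: reachable_awalk)
  show "graph_dist G x t = g x"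
    unfolding graph_dist_def
  proof (rule Least_equality)
    show "\<exists>p. awalk x p t \<and> length p = g x" using p lower[OF p(1)] by (metis le_antisym)
  qed (use lower in blast)
qed

section \<open>Stacking along paths\<close>

text \<open>Meant for \<open>t\<close> outside \<open>X\<close>, since the cups on \<open>t\<close>
  would otherwise count twice.\<close>

definition stack_on :: "'a \<Rightarrow> 'a set \<Rightarrow> ('a \<Rightarrow> nat) \<Rightarrow> 'a \<Rightarrow> nat" where
  "stack_on t X c = (\<lambda>x. if x = t then c t + sum c X else if x \<in> X then 0 else c x)"

lemma stack_on_stack_on:
  assumes "finite X" "finite Y" "X \<inter> Y = {}" "t \<notin> Y"
  shows "stack_on t Y (stack_on t X c) = stack_on t (X \<union> Y) c"
proof -
  have "sum (stack_on t X c) Y = sum c Y"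
    using assms by (intro sum.cong) (auto simp: stack_on_def)
  then show ?thesis using assms by (auto simp: stack_on_def fun_eq_iff sum.union_disjoint)
qed

lemma stack_on_empty [simp]: "stack_on t {} c = c"
  by (auto simp: stack_on_def)

text \<open>The empty list counts as a path, so a path cut anywhere yields paths on both
  sides.\<close>

definition is_path :: "'a pair_pre_digraph \<Rightarrow> 'a list \<Rightarrow> bool" where
  "is_path G xs \<longleftrightarrow> set xs \<subseteq> pverts G \<and> distinct xs \<and> successively (\<lambda>x y. (x, y) \<in> parcs G) xs"

lemma is_path_append_iff:
  "is_path G (xs @ ys) \<longleftrightarrow> is_path G xs \<and> is_path G ys \<and> set xs \<inter> set ys = {} \<and>
     (xs = [] \<or> ys = [] \<or> (last xs, hd ys) \<in> parcs G)"
  by (auto simp: is_path_def successively_append_iff)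

lemma is_path_nth: "is_path G xs \<Longrightarrow> Suc i < length xs \<Longrightarrow> (xs ! i, xs ! Suc i) \<in> parcs G"
  unfolding is_path_def
proof (elim conjE)
  show "successively (\<lambda>x y. (x, y) \<in> parcs G) xs \<Longrightarrow> Suc i < length xs \<Longrightarrow> (xs ! i, xs ! Suc i) \<in> parcs G"
    by (induct xs arbitrary: i) (auto simp: successively_Cons nth_Cons hd_conv_nth split: nat.splits)
qed

lemma (in pair_sym_digraph) is_path_rev: "is_path G (rev xs) \<longleftrightarrow> is_path G xs"
  using arcs_symmetric by (auto simp: is_path_def elim!: successively_mono)

lemma is_path_if_vpath: "vpath q (with_proj G) \<Longrightarrow> is_path G q"
proof -
  have "set (vwalk_arcs q) \<subseteq> A \<Longrightarrow> successively (\<lambda>x y. (x, y) \<in> A) q" for A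
    by (induct q rule: vwalk_arcs.induct) auto
  then show "vpath q (with_proj G) \<Longrightarrow> is_path G q"
    by (auto simp: vpath_def vwalk_def is_path_def)
qed

context connected_pair_graph
begin

lemma move_stack:
  assumes "x \<in> pverts G" "t \<in> pverts G" "x \<noteq> t" "c x = graph_dist G x t" "0 < c t"
  shows "cup_move G c (stack_on t {x} c)"
proof -
  have "stack_on t {x} c = c(x := 0, t := c t + c x)"
    using assms(3) by (auto simp: stack_on_def fun_eq_iff)
  moreover have "1 \<le> c x" "1 \<le> c t" using assms graph_dist_eq_0_iff[of x t] by simp_all
  ultimately show ?thesis
    using cup_move.intros[of x G t c, OF assms(1-3) _ _ assms(4)[symmetric]] by metis
qed

text \<open>Block by block, the cups are gathered on a vertex at the right distance and jump to
  \<open>t\<close>. Stacking a path onto its own vertex is a hypothesis here because the induction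
  proving it goes through this lemma.\<close>

lemma gather_tileable:
  assumes "tileable (map (\<lambda>x. graph_dist G x t) xs)"
    and "is_path G xs" "t \<in> pverts G" "t \<notin> set xs" "0 < c t" "\<And>x. x \<in> set xs \<Longrightarrow> c x = 1"
    and gather_path: "\<And>ys v c. length ys \<le> length xs \<Longrightarrow> is_path G ys \<Longrightarrow> v \<in> set ys \<Longrightarrow>
      (\<And>x. x \<in> set ys \<Longrightarrow> c x = 1) \<Longrightarrow> (cup_move G)\<^sup>*\<^sup>* c (stack_on v (set ys - {v}) c)"
  shows "(cup_move G)\<^sup>*\<^sup>* c (stack_on t (set xs) c)"
  using assms
proof (induct "map (\<lambda>x. graph_dist G x t) xs" arbitrary: xs c rule: tileable.induct)
  case Nil
  then show ?case by simp
next
  case (block ys zs)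
  from \<open>ys @ zs = map (\<lambda>x. graph_dist G x t) xs\<close> obtain us vs where xs: "xs = us @ vs"
    and us: "ys = map (\<lambda>x. graph_dist G x t) us" and vs: "zs = map (\<lambda>x. graph_dist G x t) vs"
    by (metis append_eq_map_conv)
  from block(1) us obtain v where v: "v \<in> set us" "graph_dist G v t = length us"
    by (metis imageE length_map list.set_map)
  have path: "is_path G us" "is_path G vs" "set us \<inter> set vs = {}"
    using block.prems(1) xs by (auto simp: is_path_append_iff)
  define c1 where "c1 = stack_on v (set us - {v}) c"
  define c2 where "c2 = stack_on t (set us) c"
  have "(cup_move G)\<^sup>*\<^sup>* c c1"
    unfolding c1_def using block.prems(5) path(1) v(1) xs by (intro block.prems(6)) auto
  also have "(cup_move G)\<^sup>*\<^sup>* c1 c2"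
  proof -
    \<comment> \<open>Every vertex of the block still carries one cup, so \<open>v\<close> collects
      exactly as many cups as its distance to \<open>t\<close>.\<close>
    have "sum c (set us) = (\<Sum>x\<in>set us. 1)"
      using block.prems(5) xs by (intro sum.cong) auto
    then have sum: "sum c (set us) = length us"
      using path(1) by (simp add: is_path_def distinct_card)
    then have c1v: "c1 v = length us"
      using v(1) by (simp add: c1_def stack_on_def sum.remove)
    with sum c1v have "stack_on t {v} c1 = c2"
      using v(1) block.prems(3) xs by (auto simp: c1_def c2_def stack_on_def fun_eq_iff)
    moreover have "(cup_move G)\<^sup>*\<^sup>* c1 (stack_on t {v} c1)"
      using v path(1) block.prems(2-4) xs c1v
      by (intro r_into_rtranclp move_stack) (auto simp: is_path_def c1_def stack_on_def)
    ultimately show ?thesis by simp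
  qed
  also have "(cup_move G)\<^sup>*\<^sup>* c2 (stack_on t (set vs) c2)"
    using vs path block.prems xs by (intro block.hyps(3)) (auto simp: c2_def stack_on_def)
  also have "stack_on t (set vs) c2 = stack_on t (set xs) c"
    unfolding c2_def xs set_append using path block.prems(3) xs by (intro stack_on_stack_on) auto
  finally show ?case .
qed

lemma tileable_graph_dist_arm:
  assumes "is_path G (v # xs)"
  shows "tileable (map (\<lambda>x. graph_dist G x v) xs)"
proof (rule tileable_if_slowly_growing)
  have v: "v \<in> pverts G" "v \<notin> set xs" "set xs \<subseteq> pverts G" using assms by (auto simp: is_path_def)
  show "0 < map (\<lambda>x. graph_dist G x v) xs ! i" if "i < length (map (\<lambda>x. graph_dist G x v) xs)" for i
    using that v graph_dist_eq_0_iff[of "xs ! i" v] nth_mem[of i xs] by fastforce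
  have adj: "graph_dist G ((v # xs) ! Suc i) v \<le> graph_dist G ((v # xs) ! i) v + 1"
    if "Suc i < length (v # xs)" for i
    using graph_dist_arc_le[OF arcs_symmetric[OF is_path_nth[OF assms that]] v(1)] .
  show "map (\<lambda>x. graph_dist G x v) xs ! 0 \<le> 1" if "map (\<lambda>x. graph_dist G x v) xs \<noteq> []"
    using that adj[of 0] graph_dist_eq_0_iff[of v v] v by auto
  show "map (\<lambda>x. graph_dist G x v) xs ! Suc i \<le> map (\<lambda>x. graph_dist G x v) xs ! i + 1"
    if "Suc i < length (map (\<lambda>x. graph_dist G x v) xs)" for i
    using that adj[of "Suc i"] by simp
qed

text \<open>Both arms at \<open>v\<close> are tileable and shorter than the path, so induction
  gathers their blocks. The first arm is reversed to start next to \<open>v\<close>.\<close>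

lemma gather_path:
  assumes "is_path G xs" "v \<in> set xs" "\<And>x. x \<in> set xs \<Longrightarrow> c x = 1"
  shows "(cup_move G)\<^sup>*\<^sup>* c (stack_on v (set xs - {v}) c)"
  using assms
proof (induct "length xs" arbitrary: xs v c rule: less_induct)
  case less
  from less.prems(2) obtain us vs where xs: "xs = us @ v # vs" by (meson split_list)
  have paths: "is_path G (v # vs)" "is_path G (us @ [v])" "set us \<inter> set (v # vs) = {}"
    using less.prems(1) xs by (auto simp: is_path_append_iff) (auto simp: is_path_def)
  then have paths': "is_path G (v # rev us)" "is_path G vs" "is_path G (rev us)"
    "v \<in> pverts G" "v \<notin> set us" "v \<notin> set vs"
    using is_path_rev[of "us @ [v]"] is_path_append_iff[of G "[v]" vs] is_path_append_iff[of G "[v]" "rev us"]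
    by (auto simp: is_path_def)
  have IH: "(cup_move G)\<^sup>*\<^sup>* c (stack_on v (set ys - {v}) c)"
    if "length ys < length xs" "is_path G ys" "v \<in> set ys" "\<And>x. x \<in> set ys \<Longrightarrow> c x = 1" for ys v c
    using less.hyps[OF that] .
  define c1 where "c1 = stack_on v (set us) c"
  have "(cup_move G)\<^sup>*\<^sup>* c (stack_on v (set (rev us)) c)"
    using paths' less.prems(3) xs tileable_graph_dist_arm[OF paths'(1)]
    by (intro gather_tileable IH) auto
  moreover have "(cup_move G)\<^sup>*\<^sup>* c1 (stack_on v (set vs) c1)"
    using paths paths' less.prems(3) xs tileable_graph_dist_arm[OF paths(1)]
    by (intro gather_tileable IH) (auto simp: c1_def stack_on_def)
  moreover have "stack_on v (set vs) c1 = stack_on v (set xs - {v}) c"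
  proof -
    have "set xs - {v} = set us \<union> set vs" using xs paths' by auto
    then show ?thesis unfolding c1_def using paths paths' by (simp add: stack_on_stack_on)
  qed
  ultimately show ?case by (simp add: c1_def)
qed

text \<open>The path through \<open>t\<close> is gathered first. The others follow one by one, each
  still with one cup per vertex because the paths are disjoint.\<close>

lemma stackable_at_if_path_family:
  assumes "finite Q" "\<And>q. q \<in> Q \<Longrightarrow> is_path G (p q)" "disjoint_family_on (set \<circ> p) Q"
    "(\<Union>q\<in>Q. set (p q)) = pverts G" "t \<in> pverts G"
    and tileable: "\<And>q. q \<in> Q \<Longrightarrow> t \<notin> set (p q) \<Longrightarrow> tileable (map (\<lambda>x. graph_dist G x t) (p q))"
  shows "stackable_at G t"
proof -
  from assms(4,5) obtain q0 where q0: "q0 \<in> Q" "t \<in> set (p q0)" by blast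
  \<comment> \<open>The vertices already emptied when \<open>p q0\<close> and the paths in
    \<open>R\<close> are done.\<close>
  let ?U = "\<lambda>R. (\<Union>q\<in>insert q0 R. set (p q)) - {t}"
  have disj: "set (p q) \<inter> set (p q') = {}" if "q \<in> Q" "q' \<in> Q" "q \<noteq> q'" for q q'
    using disjoint_family_onD[OF assms(3)] that by auto
  have init: "initial_cups G x = 1" if "x \<in> pverts G" for x
    using that by (simp add: initial_cups_def)
  have gather: "(cup_move G)\<^sup>*\<^sup>* (initial_cups G) (stack_on t (?U R) (initial_cups G))"
    if "R \<subseteq> Q - {q0}" for R
    using finite_subset[OF that finite_Diff[OF assms(1)]] that
  proof (induct R rule: finite_induct)
    case empty
    have "is_path G (p q0)" by (fact assms(2)[OF q0(1)])
    then show ?case using gather_path[of "p q0" t "initial_cups G"] q0(2) init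
      by (auto simp: is_path_def)
  next
    case (insert q R)
    define c where "c = stack_on t (?U R) (initial_cups G)"
    have q: "q \<in> Q" "q \<noteq> q0" using insert.prems by auto
    have path: "is_path G (p q)" by (fact assms(2)[OF q(1)])
    have t: "t \<notin> set (p q)" using disj[OF q(1) q0(1) q(2)] q0(2) by blast
    have U: "?U R \<inter> set (p q) = {}"
      using disj[OF _ q(1)] insert.hyps(2) insert.prems q q0(1) by blast
    have one: "c x = 1" if "x \<in> set (p q)" for x
      using that t U path init[of x] by (auto simp: c_def stack_on_def is_path_def)
    have "0 < c t" using init[OF assms(5)] by (simp add: c_def stack_on_def)
    then have "(cup_move G)\<^sup>*\<^sup>* c (stack_on t (set (p q)) c)"
      using t path one tileable[OF q(1)] assms(5) by (intro gather_tileable gather_path) auto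
    also have "stack_on t (set (p q)) c = stack_on t (?U R \<union> set (p q)) (initial_cups G)"
      unfolding c_def using insert.hyps(1) U t by (intro stack_on_stack_on) auto
    also have "?U R \<union> set (p q) = ?U (insert q R)" using t by auto
    finally show ?case using insert.hyps(3) insert.prems by (auto simp: c_def)
  qed
  have "insert q0 (Q - {q0}) = Q" using q0(1) by blast
  then have "stack_on t (?U (Q - {q0})) (initial_cups G) v = 0" if "v \<noteq> t" for v
    using that assms(4) by (auto simp: stack_on_def initial_cups_def)
  with gather[of "Q - {q0}"] show ?thesis unfolding stackable_at_def by blast
qed

end

section \<open>Grids in Cartesian powers\<close>

lemma (in pair_wf_digraph) parcs_cart_power_iff:
  assumes "xs \<in> pverts (cart_power G r)"
  shows "(xs, ys) \<in> parcs (cart_power G r) \<longleftrightarrow>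
    (\<exists>i<r. \<exists>b. (xs ! i, b) \<in> parcs G \<and> ys = xs[i := b])"
  using assms
proof (induct r arbitrary: xs ys)
  case 0
  then show ?case by simp
next
  case (Suc r)
  from Suc.prems obtain x xs' where xs: "xs = x # xs'" "x \<in> pverts G" "xs' \<in> pverts (cart_power G r)"
    by (auto simp: pverts_cart_power length_Suc_conv simp del: cart_power.simps)
  have wf: "parcs (cart_power G (Suc r)) \<subseteq> pverts (cart_power G (Suc r)) \<times> pverts (cart_power G (Suc r))"
    by (auto simp: relabel_def cart_prod_def)
  have upd: "xs'[i := b] \<in> pverts (cart_power G r)" if "(xs' ! i, b) \<in> parcs G" for i b
    using xs(3) in_arcsD2[OF that] set_update_subset_insert[of xs' i b]
    by (auto simp: pverts_cart_power)
  show ?case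
  proof
    assume arc: "(xs, ys) \<in> parcs (cart_power G (Suc r))"
    then have "ys \<in> pverts (cart_power G (Suc r))" using wf by blast
    then obtain y ys' where ys: "ys = y # ys'"
      by (auto simp: pverts_cart_power length_Suc_conv simp del: cart_power.simps)
    from arc consider (tl) "x = y" "(xs', ys') \<in> parcs (cart_power G r)"
      | (hd) "(x, y) \<in> parcs G" "xs' = ys'"
      unfolding xs(1) ys parcs_cart_power_Suc by blast
    then show "\<exists>i<Suc r. \<exists>b. (xs ! i, b) \<in> parcs G \<and> ys = xs[i := b]"
    proof cases
      case tl
      then obtain i b where "i < r" "(xs' ! i, b) \<in> parcs G" "ys' = xs'[i := b]"
        using Suc.hyps[OF xs(3)] by blast
      then show ?thesis using xs ys tl by (intro exI[of _ "Suc i"]) auto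
    next
      case hd
      then show ?thesis using xs ys by (intro exI[of _ 0]) auto
    qed
  next
    assume "\<exists>i<Suc r. \<exists>b. (xs ! i, b) \<in> parcs G \<and> ys = xs[i := b]"
    then obtain i b where i: "i < Suc r" "(xs ! i, b) \<in> parcs G" "ys = xs[i := b]" by blast
    show "(xs, ys) \<in> parcs (cart_power G (Suc r))"
    proof (cases i)
      case 0
      then show ?thesis using i xs in_arcsD2[OF i(2)]
        by (simp add: parcs_cart_power_Suc del: cart_power.simps)
    next
      case (Suc j)
      then have j: "(xs' ! j, b) \<in> parcs G" "ys = x # xs'[j := b]" "j < r" using i xs by auto
      then have "(xs', xs'[j := b]) \<in> parcs (cart_power G r)" using Suc.hyps[OF xs(3)] by blast
      then show ?thesis using j xs upd[OF j(1)]
        by (simp add: parcs_cart_power_Suc del: cart_power.simps)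
    qed
  qed
qed

text \<open>Written additively to avoid subtraction of natural numbers.\<close>

lemma sum_nth_list_update:
  fixes h :: "nat \<Rightarrow> 'a \<Rightarrow> nat"
  assumes "i < r" "length xs = r"
  shows "(\<Sum>j<r. h j (xs[i := b] ! j)) + h i (xs ! i) = (\<Sum>j<r. h j (xs ! j)) + h i b"
proof -
  have "(\<Sum>j\<in>{..<r} - {i}. h j (xs[i := b] ! j)) = (\<Sum>j\<in>{..<r} - {i}. h j (xs ! j))"
    by (intro sum.cong) auto
  then show ?thesis using assms by (simp add: sum.remove[of "{..<r}" i])
qed

context connected_pair_graph
begin

text \<open>An arc moves one coordinate, so the sum changes by at most one, and a coordinate
  differing from its target can be brought closer. Hence \<open>reachable_and_graph_dist_eqI\<close>
  applies.\<close>

lemma reachable_and_graph_dist_cart_power: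
  assumes "xs \<in> pverts (cart_power G r)" "ts \<in> pverts (cart_power G r)"
  shows "xs \<rightarrow>\<^sup>*\<^bsub>with_proj (cart_power G r)\<^esub> ts" (is ?reach)
    and "graph_dist (cart_power G r) xs ts = (\<Sum>i<r. graph_dist G (xs ! i) (ts ! i))" (is ?dist)
proof -
  interpret P: pair_graph "cart_power G r" by (rule pair_graph_cart_power[OF pair_graph])
  let ?g = "\<lambda>xs. \<Sum>i<r. graph_dist G (xs ! i) (ts ! i)"
  have V: "length ys = r \<and> (\<forall>i<r. ys ! i \<in> pverts G)" if "ys \<in> pverts (cart_power G r)" for ys
    using that nth_mem[of _ ys] by (auto simp: pverts_cart_power)
  note tsV = V[OF assms(2)]
  have zero: "?g ts = 0"
    using graph_dist_eq_0_iff tsV by simp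
  have lip: "?g ys \<le> ?g zs + 1" if "(ys, zs) \<in> parcs (cart_power G r)" for ys zs
  proof -
    have ys: "ys \<in> pverts (cart_power G r)" using P.in_arcsD1[OF that] .
    from that parcs_cart_power_iff[OF ys] obtain i b where
      i: "i < r" "(ys ! i, b) \<in> parcs G" "zs = ys[i := b]" by blast
    then show ?thesis
      using sum_nth_list_update[of i r ys "\<lambda>j y. graph_dist G y (ts ! j)" b] V[OF ys]
        graph_dist_arc_le[OF i(2), of "ts ! i"] tsV by simp
  qed
  have desc: "\<exists>zs. (ys, zs) \<in> parcs (cart_power G r) \<and> ?g zs < ?g ys"
    if ys: "ys \<in> pverts (cart_power G r)" and "ys \<noteq> ts" for ys
  proof -
    obtain i where i: "i < r" "ys ! i \<noteq> ts ! i"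
      using V[OF ys] tsV \<open>ys \<noteq> ts\<close> by (metis nth_equalityI)
    then obtain b where b: "(ys ! i, b) \<in> parcs G" "graph_dist G b (ts ! i) < graph_dist G (ys ! i) (ts ! i)"
      using graph_dist_closer[of "ys ! i" "ts ! i"] V[OF ys] tsV by blast
    then have "(ys, ys[i := b]) \<in> parcs (cart_power G r)"
      using parcs_cart_power_iff[OF ys] i by blast
    moreover have "?g (ys[i := b]) < ?g ys"
      using sum_nth_list_update[of i r ys "\<lambda>j y. graph_dist G y (ts ! j)" b] V[OF ys] i b by simp
    ultimately show ?thesis by blast
  qed
  show ?reach ?dist
    using P.reachable_and_graph_dist_eqI[of ts ?g, OF assms(2) zero lip desc assms(1)] by simp_all
qed

lemma connected_pair_graph_cart_power: "connected_pair_graph (cart_power G r)"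
  using pair_graph_cart_power[OF pair_graph, of r] reachable_and_graph_dist_cart_power(1)
  by (simp add: connected_pair_graph_def connected_pair_graph_axioms_def)

end

section \<open>Hamiltonian paths of grids\<close>

text \<open>The boustrophedon traversal of a grid. The pairing \<open>f\<close> is a parameter so
  that either factor can supply the rows.\<close>

fun snake :: "('a \<Rightarrow> 'b \<Rightarrow> 'c) \<Rightarrow> 'a list \<Rightarrow> 'b list \<Rightarrow> 'c list" where
  "snake f xs [] = []"
| "snake f xs (y # ys) = map (\<lambda>x. f x y) xs @ snake f (rev xs) ys"

lemma set_snake: "set (snake f xs ys) = {f x y | x y. x \<in> set xs \<and> y \<in> set ys}"
  by (induct f xs ys rule: snake.induct) auto

lemma length_snake: "length (snake f xs ys) = length xs * length ys"
  by (induct f xs ys rule: snake.induct) auto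

lemma snake_nth: "i < length xs \<Longrightarrow> ys \<noteq> [] \<Longrightarrow> snake f xs ys ! i = f (xs ! i) (ys ! 0)"
  by (cases ys) (auto simp: nth_append)

text \<open>Since the next row is reversed, each turn changes only the second argument of
  \<open>f\<close>, along an arc of \<open>H\<close>.\<close>

lemma is_path_snake:
  assumes "pair_sym_digraph G" "is_path G xs" "is_path H ys" "xs \<noteq> []"
    and vert: "\<And>x y. x \<in> pverts G \<Longrightarrow> y \<in> pverts H \<Longrightarrow> f x y \<in> pverts K"
    and inj: "\<And>x y x' y'. f x y = f x' y' \<Longrightarrow> x = x' \<and> y = y'"
    and arc1: "\<And>x x' y. (x, x') \<in> parcs G \<Longrightarrow> y \<in> pverts H \<Longrightarrow> (f x y, f x' y) \<in> parcs K"
    and arc2: "\<And>x y y'. x \<in> pverts G \<Longrightarrow> (y, y') \<in> parcs H \<Longrightarrow> (f x y, f x y') \<in> parcs K"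
  shows "is_path K (snake f xs ys)"
  using assms(2-4)
proof (induct ys arbitrary: xs)
  case Nil
  then show ?case by (simp add: is_path_def)
next
  case (Cons y ys)
  interpret G: pair_sym_digraph G by fact
  have y: "y \<in> pverts H" "y \<notin> set ys" "is_path H ys"
    using Cons.prems(2) is_path_append_iff[of H "[y]" ys] by (auto simp: is_path_def)
  have xsV: "set xs \<subseteq> pverts G" using Cons.prems(1) by (simp add: is_path_def)
  have "is_path K (map (\<lambda>x. f x y) xs)"
    using Cons.prems(1) y inj vert
    by (auto simp: is_path_def distinct_map inj_on_def successively_map intro: arc1 elim!: successively_mono)
  moreover have "is_path K (snake f (rev xs) ys)"
    using Cons y by (intro Cons.hyps) (auto simp: G.is_path_rev)
  moreover have "set (map (\<lambda>x. f x y) xs) \<inter> set (snake f (rev xs) ys) = {}"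
    using y(2) inj by (force simp: set_snake)
  moreover have "(last (map (\<lambda>x. f x y) xs), hd (snake f (rev xs) ys)) \<in> parcs K" if ne: "ys \<noteq> []"
  proof -
    obtain y' ys' where ys: "ys = y' # ys'" using ne by (cases ys) auto
    have "(y, y') \<in> parcs H" using Cons.prems(2) ys by (simp add: is_path_def)
    then show ?thesis using Cons.prems(3) xsV ys
      by (auto simp: last_map hd_append hd_map hd_rev intro!: arc2)
  qed
  ultimately show ?case by (cases "ys = []") (simp_all add: is_path_append_iff)
qed

lemma power_le_prod_list:
  fixes k :: nat
  assumes "\<And>q. q \<in> set qs \<Longrightarrow> k \<le> h q"
  shows "k ^ length qs \<le> prod_list (map h qs)"
  using assms by (induct qs) (auto intro!: mult_le_mono)

text \<open>The index \<open>j\<close> prescribes the coordinate changed by the first step. For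
  \<open>j = 0\<close> the rows run along \<open>q\<close>; otherwise they run along the path of the
  remaining coordinates, which by induction starts in direction \<open>j - 1\<close>.\<close>

lemma (in pair_graph) cart_power_grid_path:
  assumes "\<And>q. q \<in> set qs \<Longrightarrow> is_path G q" "\<And>q. q \<in> set qs \<Longrightarrow> 2 \<le> length q"
  shows "\<exists>p. is_path (cart_power G (length qs)) p \<and>
    set p = {xs. list_all2 (\<lambda>x q. x \<in> set q) xs qs} \<and>
    length p = prod_list (map length qs) \<and> p ! 0 = map (\<lambda>q. q ! 0) qs \<and>
    (j < length qs \<longrightarrow> 2 \<le> length p \<and> p ! 1 = (map (\<lambda>q. q ! 0) qs)[j := qs ! j ! 1])"
  using assms
proof (induct qs arbitrary: j)
  case Nil
  show ?case by (intro exI[of _ "[[]]"]) (simp add: is_path_def)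
next
  case (Cons q qs)
  let ?P = "cart_power G (length qs)"
  have q: "is_path G q" "2 \<le> length q" using Cons.prems by auto
  interpret P: pair_graph ?P by (rule pair_graph_cart_power[OF pair_graph])
  have "\<exists>p. is_path ?P p \<and> set p = {xs. list_all2 (\<lambda>x q. x \<in> set q) xs qs} \<and>
    length p = prod_list (map length qs) \<and> p ! 0 = map (\<lambda>q. q ! 0) qs \<and>
    (j - 1 < length qs \<longrightarrow> 2 \<le> length p \<and> p ! 1 = (map (\<lambda>q. q ! 0) qs)[j - 1 := qs ! (j - 1) ! 1])"
    using Cons.prems by (intro Cons.hyps) auto
  then obtain p where p: "is_path ?P p"
    "set p = {xs. list_all2 (\<lambda>x q. x \<in> set q) xs qs}"
    "length p = prod_list (map length qs)" "p ! 0 = map (\<lambda>q. q ! 0) qs"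
    "j - 1 < length qs \<longrightarrow> 2 \<le> length p \<and> p ! 1 = (map (\<lambda>q. q ! 0) qs)[j - 1 := qs ! (j - 1) ! 1]"
    by blast
  \<comment> \<open>Makes \<open>p\<close> nonempty, so that the snake has a first row.\<close>
  have "2 ^ length qs \<le> length p" unfolding p(3) using Cons.prems(2) by (intro power_le_prod_list) auto
  then have ne: "p \<noteq> []" "q \<noteq> []" using q(2) by auto
  note arcsD = P.in_arcsD1 P.in_arcsD2 in_arcsD1 in_arcsD2
  have vert: "x # xs \<in> pverts (cart_power G (Suc (length qs)))" if "x \<in> pverts G" "xs \<in> pverts ?P" for x xs
    using that by (simp add: pverts_cart_power del: cart_power.simps)
  show ?case
  proof (cases j)
    case 0
    let ?s = "snake (\<lambda>x xs. x # xs) q p"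
    have "is_path (cart_power G (Suc (length qs))) ?s"
      by (rule is_path_snake[OF pair_sym_digraph_axioms q(1) p(1) ne(2)])
        (auto simp: parcs_cart_power_Suc vert simp del: cart_power.simps intro: arcsD)
    moreover have "set ?s = {xs. list_all2 (\<lambda>x q. x \<in> set q) xs (q # qs)}"
      using p(2) by (auto simp: set_snake list_all2_Cons2)
    moreover have "2 \<le> length ?s"
      using mult_le_mono[OF q(2), of 1 "length p"] ne by (simp add: length_snake Suc_leI)
    ultimately show ?thesis using 0 p q ne
      by (intro exI[of _ ?s]) (auto simp: length_snake snake_nth simp del: cart_power.simps)
  next
    case (Suc i)
    let ?s = "snake (\<lambda>xs x. x # xs) p q"
    have "is_path (cart_power G (Suc (length qs))) ?s"
      by (rule is_path_snake[OF P.pair_sym_digraph_axioms p(1) q(1) ne(1)])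
        (auto simp: parcs_cart_power_Suc vert simp del: cart_power.simps intro: arcsD)
    moreover have "set ?s = {xs. list_all2 (\<lambda>x q. x \<in> set q) xs (q # qs)}"
      using p(2) by (auto simp: set_snake list_all2_Cons2)
    moreover have "2 \<le> length ?s" if "2 \<le> length p"
      using mult_le_mono[OF that, of 1 "length q"] q(2) by (simp add: length_snake)
    moreover have "?s ! 0 = map (\<lambda>q. q ! 0) (q # qs)" using snake_nth[of 0 p q] p(4) ne by simp
    ultimately show ?thesis using Suc p q ne
      by (intro exI[of _ ?s]) (auto simp: length_snake snake_nth mult.commute simp del: cart_power.simps)
  qed
qed

text \<open>If all neighbours of a corner in the coordinate directions are closer to \<open>t\<close>
  and the corner has distance 2 from \<open>t\<close>, then \<open>r \<ge> 2\<close> forces \<open>t\<close> into the grid.\<close>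

lemma (in connected_pair_graph) tileable_grid_path:
  assumes bip: "bipartite G" and r: "length qs = r" "2 \<le> r"
    and qs: "\<And>q. q \<in> set qs \<Longrightarrow> is_path G q" "\<And>q. q \<in> set qs \<Longrightarrow> k \<le> length q" "2 \<le> k"
    and long: "(graph_diameter G * r)\<^sup>2 \<le> k ^ r"
    and ts: "ts \<in> pverts (cart_power G r)"
  shows "\<exists>p. is_path (cart_power G r) p \<and> set p = {xs. list_all2 (\<lambda>x q. x \<in> set q) xs qs} \<and>
    (ts \<notin> set p \<longrightarrow> tileable (map (\<lambda>x. graph_dist (cart_power G r) x ts) p))"
proof -
  let ?d = "\<lambda>i j. graph_dist G (qs ! i ! j) (ts ! i)"
  \<comment> \<open>The first step leads away from \<open>ts\<close> whenever some direction at the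
    corner does.\<close>
  define j where "j = (if \<exists>i<r. ?d i 1 = ?d i 0 + 1 then SOME i. i < r \<and> ?d i 1 = ?d i 0 + 1 else 0)"
  have len2: "2 \<le> length q" if "q \<in> set qs" for q using qs(2)[OF that] qs(3) by simp
  have j: "j < r" using someI_ex[of "\<lambda>i. i < r \<and> ?d i 1 = ?d i 0 + 1"] r(2) by (auto simp: j_def)
  from cart_power_grid_path[of qs j, OF qs(1) len2] r(1) j obtain p where p: "is_path (cart_power G r) p"
    "set p = {xs. list_all2 (\<lambda>x q. x \<in> set q) xs qs}" "length p = prod_list (map length qs)"
    "p ! 0 = map (\<lambda>q. q ! 0) qs" "2 \<le> length p" "p ! 1 = (map (\<lambda>q. q ! 0) qs)[j := qs ! j ! 1]"
    by metis
  interpret P: connected_pair_graph "cart_power G r" by (rule connected_pair_graph_cart_power)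
  let ?f = "\<lambda>x. graph_dist (cart_power G r) x ts"
  have V: "length ys = r \<and> (\<forall>i<r. ys ! i \<in> pverts G)" if "ys \<in> pverts (cart_power G r)" for ys
    using that nth_mem[of _ ys] by (auto simp: pverts_cart_power)
  have pV: "p ! i \<in> pverts (cart_power G r)" if "i < length p" for i
    using p(1) that by (auto simp: is_path_def)
  have f: "?f x = (\<Sum>i<r. graph_dist G (x ! i) (ts ! i))" if "x \<in> pverts (cart_power G r)" for x
    using reachable_and_graph_dist_cart_power(2)[OF that ts] .
  have "tileable (map ?f p)" if "ts \<notin> set p"
  proof -
    interpret zigzag "map ?f p" "graph_diameter G * r"
    proof
      fix i
      show "0 < map ?f p ! i" if "i < length (map ?f p)"
        using that P.graph_dist_eq_0_iff[OF pV ts] \<open>ts \<notin> set p\<close> nth_mem[of i p] by fastforce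
      show "map ?f p ! i \<le> graph_diameter G * r" if i: "i < length (map ?f p)"
      proof -
        have "?f (p ! i) \<le> (\<Sum>i<r. graph_diameter G)"
          unfolding f[OF pV[OF i[simplified]]] using V[OF pV[OF i[simplified]]] V[OF ts]
          by (intro sum_mono graph_dist_le_diameter) auto
        then show ?thesis using i by (simp add: mult.commute)
      qed
      show "map ?f p ! Suc i = map ?f p ! i + 1 \<or> map ?f p ! i = map ?f p ! Suc i + 1"
        if i: "Suc i < length (map ?f p)"
      proof -
        \<comment> \<open>One coordinate moves along an arc of the bipartite graph \<open>G\<close>,
          so its distance changes by exactly one.\<close>
        have pi: "p ! i \<in> pverts (cart_power G r)" "p ! Suc i \<in> pverts (cart_power G r)"
          using i pV by auto
        from i is_path_nth[OF p(1), of i] parcs_cart_power_iff[OF pi(1)] obtain m b where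
          m: "m < r" "(p ! i ! m, b) \<in> parcs G" "p ! Suc i = (p ! i)[m := b]" by auto
        show ?thesis
          using sum_nth_list_update[of m r "p ! i" "\<lambda>j y. graph_dist G y (ts ! j)" b] V[OF pi(1)] V[OF ts] m i
            graph_dist_arc_cases[OF bip m(2), of "ts ! m"] f[OF pi(1)] f[OF pi(2)] by auto
      qed
    qed
    have d: "?d i 1 = ?d i 0 + 1 \<or> ?d i 0 = ?d i 1 + 1" if "i < r" for i
    proof -
      have "(qs ! i ! 0, qs ! i ! 1) \<in> parcs G"
        using is_path_nth[of G "qs ! i" 0] qs(1)[of "qs ! i"] len2[of "qs ! i"] that r(1) by simp
      then show ?thesis using graph_dist_arc_cases[OF bip] V[OF ts] that by blast
    qed
    have p01: "p ! 0 \<in> pverts (cart_power G r)" "p ! 1 \<in> pverts (cart_power G r)"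
      using p(5) by (auto intro!: pV)
    have f0: "?f (p ! 0) = (\<Sum>i<r. ?d i 0)"
      using f[OF p01(1)] p(4) r(1) by simp
    have "?f (p ! 1) + ?d j 0 = ?f (p ! 0) + ?d j 1"
    proof -
      have "?f (p ! 1) = (\<Sum>i<r. graph_dist G ((p ! 0)[j := qs ! j ! 1] ! i) (ts ! i))"
        using f[OF p01(2)] p(4,6) by simp
      then show ?thesis
        using sum_nth_list_update[of j r "p ! 0" "\<lambda>j y. graph_dist G y (ts ! j)" "qs ! j ! 1"]
          f[OF p01(1)] p(4) r(1) j by simp
    qed
    have "\<not> (map ?f p ! 0 = 2 \<and> map ?f p ! 1 = 1)"
    proof
      assume "map ?f p ! 0 = 2 \<and> map ?f p ! 1 = 1"
      then have bad: "?f (p ! 0) = 2" "?f (p ! 1) = 1" using p(5)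
        nth_map[of 0 p ?f] nth_map[of 1 p ?f] by linarith+
      \<comment> \<open>If some direction led away, \<open>j\<close> would be one and the first step
        would increase the distance.\<close>
      have down: "?d i 0 = ?d i 1 + 1" if "i < r" for i
      proof (rule ccontr)
        assume "\<not> ?thesis"
        then have ex: "\<exists>i<r. ?d i 1 = ?d i 0 + 1" using d that by blast
        then have "?d j 1 = ?d j 0 + 1"
          using someI_ex[of "\<lambda>i. i < r \<and> ?d i 1 = ?d i 0 + 1"] by (simp add: j_def)
        then show False using bad \<open>?f (p ! 1) + ?d j 0 = ?f (p ! 0) + ?d j 1\<close> by simp
      qed
      \<comment> \<open>The distance 2 of the corner is the sum of the \<open>?d i 1\<close> plus
        \<open>r \<ge> 2\<close>, so that sum vanishes and \<open>ts\<close> consists of the second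
        vertices of the paths.\<close>
      have "(\<Sum>i<r. ?d i 0) = (\<Sum>i<r. ?d i 1 + 1)" using down by (intro sum.cong) auto
      also have "\<dots> = (\<Sum>i<r. ?d i 1) + r" by (simp only: sum.distrib) simp
      finally have "(\<Sum>i<r. ?d i 1) = 0" using bad f0 r(2) by linarith
      then have z: "?d i 1 = 0" if "i < r" for i using that by simp
      have "ts ! i \<in> set (qs ! i)" if i: "i < r" for i
      proof -
        have mem: "qs ! i ! 1 \<in> set (qs ! i)" using len2[of "qs ! i"] r(1) i by simp
        moreover have "set (qs ! i) \<subseteq> pverts G" using qs(1)[of "qs ! i"] r(1) i by (simp add: is_path_def)
        ultimately show ?thesis using z[OF i] graph_dist_eq_0_iff[of "qs ! i ! 1" "ts ! i"] V[OF ts] i by auto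
      qed
      then have "ts \<in> set p" using p(2) V[OF ts] r(1) by (auto simp: list_all2_conv_all_nth)
      then show False using \<open>ts \<notin> set p\<close> by blast
    qed
    moreover have "(graph_diameter G * r)\<^sup>2 \<le> length (map ?f p)"
      using long power_le_prod_list[of qs k length, OF qs(2)] p(3) r(1) by simp
    ultimately show ?thesis by (intro tileable_if_long)
  qed
  then show ?thesis using p(1,2) by blast
qed

section \<open>Partition of the power into grids\<close>

lemma connected_pair_graphI:
  assumes "pair_graph G" "Digraph_Component.connected (with_proj G)"
  shows "connected_pair_graph G"
proof -
  interpret pair_graph G by fact
  \<comment> \<open>\<open>connected\<close> refers to the symmetric closure, which here is the
    graph itself.\<close>
  have "mk_symmetric (with_proj G) = G"
    using arcs_symmetric by (auto simp: mk_symmetric_def intro!: pair_pre_digraph.equality)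
  then show ?thesis
    using assms(2) by unfold_locales (auto simp: connected_def strongly_connected_def)
qed

theorem theorem3p5:
  fixes G :: "'a pair_pre_digraph"
    and P :: "'a list set"
    and d p k r :: nat
  assumes "pair_graph G"
    and "Digraph_Component.connected (with_proj G)"
    and "bipartite G"
    and "graph_diameter G = d"
    and "path_partition G P"
    and "card P = p"
    and "p \<ge> 2"
    and "\<forall>q\<in>P. length q \<ge> k"
    and "k \<ge> 2"
    and "r \<ge> 2"
    and "k ^ r \<ge> (d * r)\<^sup>2"
  shows "stackable (cart_power G r)"
  unfolding stackable_def
proof
  fix ts assume ts: "ts \<in> pverts (cart_power G r)"
  interpret connected_pair_graph G using assms(1,2) by (rule connected_pair_graphI)
  interpret P: connected_pair_graph "cart_power G r" by (rule connected_pair_graph_cart_power)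
  \<comment> \<open>Each \<open>r\<close>-tuple of paths of the partition indexes the grid that is
    their product.\<close>
  let ?Q = "{qs. set qs \<subseteq> P \<and> length qs = r}"
  from assms(5) have P: "finite P" "\<And>q. q \<in> P \<Longrightarrow> is_path G q" "disjoint_family_on set P"
    "(\<Union>q\<in>P. set q) = pverts G"
    by (auto simp: path_partition_def intro: is_path_if_vpath)
  have "\<forall>qs\<in>?Q. \<exists>p. is_path (cart_power G r) p \<and> set p = {xs. list_all2 (\<lambda>x q. x \<in> set q) xs qs} \<and>
    (ts \<notin> set p \<longrightarrow> tileable (map (\<lambda>x. graph_dist (cart_power G r) x ts) p))"
    using P(2) assms ts by (intro ballI tileable_grid_path[where k = k]) auto
  from bchoice[OF this] obtain \<pi> where \<pi>: "\<And>qs. qs \<in> ?Q \<Longrightarrow> is_path (cart_power G r) (\<pi> qs)"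
    "\<And>qs. qs \<in> ?Q \<Longrightarrow> set (\<pi> qs) = {xs. list_all2 (\<lambda>x q. x \<in> set q) xs qs}"
    "\<And>qs. qs \<in> ?Q \<Longrightarrow> ts \<notin> set (\<pi> qs) \<Longrightarrow> tileable (map (\<lambda>x. graph_dist (cart_power G r) x ts) (\<pi> qs))"
    by blast
  show "stackable_at (cart_power G r) ts"
  proof (rule P.stackable_at_if_path_family[where Q = ?Q and p = \<pi>])
    show "finite ?Q" using finite_lists_length_eq[OF P(1)] by simp
    show "disjoint_family_on (set \<circ> \<pi>) ?Q"
      unfolding disjoint_family_on_def
    proof (intro ballI impI)
      fix qs qs' assume Q: "qs \<in> ?Q" "qs' \<in> ?Q" "qs \<noteq> qs'"
      \<comment> \<open>Distinct tuples differ in some coordinate, and there the two paths are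
        disjoint.\<close>
      then obtain i where i: "i < r" "qs ! i \<noteq> qs' ! i"
        by (metis (mono_tags, lifting) mem_Collect_eq nth_equalityI)
      then have "set (qs ! i) \<inter> set (qs' ! i) = {}"
        using Q disjoint_family_onD[OF P(3)] by (simp add: subset_iff)
      then show "(set \<circ> \<pi>) qs \<inter> (set \<circ> \<pi>) qs' = {}"
        using i(1) Q \<pi>(2)[OF Q(1)] \<pi>(2)[OF Q(2)] by (fastforce simp: list_all2_conv_all_nth)
    qed
    show "(\<Union>qs\<in>?Q. set (\<pi> qs)) = pverts (cart_power G r)"
    proof
      show "(\<Union>qs\<in>?Q. set (\<pi> qs)) \<subseteq> pverts (cart_power G r)"
        using \<pi>(1) by (auto simp: is_path_def)
      show "pverts (cart_power G r) \<subseteq> (\<Union>qs\<in>?Q. set (\<pi> qs))"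
      proof
        fix xs assume xs: "xs \<in> pverts (cart_power G r)"
        \<comment> \<open>\<open>h\<close> selects a path through each vertex; applied
          coordinatewise it finds the grid of \<open>xs\<close>.\<close>
        from P(4) obtain h where h: "\<And>x. x \<in> pverts G \<Longrightarrow> h x \<in> P \<and> x \<in> set (h x)"
          by (metis UN_E)
        have "map h xs \<in> ?Q" "list_all2 (\<lambda>x q. x \<in> set q) xs (map h xs)"
          using xs h by (auto simp: pverts_cart_power list_all2_conv_all_nth subset_iff)
        then show "xs \<in> (\<Union>qs\<in>?Q. set (\<pi> qs))" using \<pi>(2) by blast
      qed
    qed
  qed (use \<pi> ts in auto)
qed

end
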